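(* Suppose that $f\in C_p(\mathbb{R})$ satisfies $\lim_{|x|\to\infty}f(x)=+\infty$. Then $$\inf_{\mu\in\mathbb{R},\,\sigma>0}F(\mu,\sigma)=\min_{x\in\mathbb{R}}f(x).$$
   Context: $C_p(\mathbb{R})$ is the set of continuous functions $f:\mathbb{R}\to\mathbb{R}$ such that $\lim_{|x|\to\infty}f(x)/|x|^m=0$ for some $m>0$. For $\mu\in\mathbb{R}$, $\sigma>0$, $\Gamma_{\mu,\sigma}(x)=\frac{1}{\sqrt{2\pi}\,\sigma}e^{-(x-\mu)^2/(2\sigma^2)}$, and the relaxed functional is $F(\mu,\sigma)=\int_{\mathbb{R}}f(x)\Gamma_{\mu,\sigma}(x)\,dx$. *)

theory Defs
  imports "HOL-Probability.Probability"
begin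

text \<open>On the reals, \<open>at_infinity\<close> is the filter of \<open>\<bar>x\<bar> \<rightarrow> \<infinity>\<close>. The exponent \<open>m\<close> is real.\<close>

definition C_p :: "(real \<Rightarrow> real) set" where
  "C_p = {f. continuous_on UNIV f \<and>
             (\<exists>m::real. m > 0 \<and> ((\<lambda>x. f x / \<bar>x\<bar> powr m) \<longlongrightarrow> 0) at_infinity)}"

text \<open>The Gaussian kernel with mean \<open>\<mu>\<close> and standard deviation \<open>\<sigma> > 0\<close> is the library's
  \<open>normal_density\<close>, whose prefactor \<open>1 / sqrt (2 * pi * \<sigma>\<^sup>2)\<close> equals \<open>1 / (sqrt (2 * pi) * \<sigma>)\<close>
  for \<open>\<sigma> > 0\<close>.\<close>

definition relaxed :: "(real \<Rightarrow> real) \<Rightarrow> real \<Rightarrow> real \<Rightarrow> real" where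
  "relaxed f \<mu> \<sigma> = (LINT x|lborel. f x * normal_density \<mu> \<sigma> x)"

end

(* The functional relaxed f \<mu> \<sigma> averages f against a probability density, so it is at least
   min f. After the substitution x = \<mu> + \<sigma> y it is the standard normal mean of f (\<mu> + \<sigma> y);
   letting \<sigma> tend to 0 at a minimiser \<mu> and using polynomial growth for dominated convergence,
   the values tend to min f. *)
theory Submission
  imports Defs
begin

text \<open>Far from the origin \<open>f\<close> exceeds \<open>f 0\<close>, so a minimum over a
  large compact ball containing \<open>0\<close> is already global.\<close>

lemma continuous_attains_inf_at_top_at_infinity:
  fixes f :: "'a::{heine_borel, real_normed_vector} \<Rightarrow> real"
  assumes "continuous_on UNIV f" and "filterlim f at_top at_infinity"
  shows "\<exists>x0. \<forall>x. f x0 \<le> f x"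
proof -
  have "eventually (\<lambda>x. f 0 \<le> f x) at_infinity"
    using assms(2) by (simp add: filterlim_at_top)
  then obtain b where b: "\<And>x. b \<le> norm x \<Longrightarrow> f 0 \<le> f x"
    unfolding eventually_at_infinity by blast
  \<comment> \<open>The radius \<open>max b 0\<close> keeps \<open>0\<close> in the ball even for
    negative \<open>b\<close>; the comparison \<open>f x0 \<le> f 0\<close> needs this.\<close>
  have "\<exists>x0\<in>cball 0 (max b 0). \<forall>x\<in>cball 0 (max b 0). f x0 \<le> f x"
    using assms(1) by (intro continuous_attains_inf) (auto intro: continuous_on_subset)
  then obtain x0 where x0: "\<And>x. norm x \<le> max b 0 \<Longrightarrow> f x0 \<le> f x"
    by (metis mem_cball_0)
  have "f x0 \<le> f x" for x
  proof (cases "norm x \<le> max b 0")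
    case False
    then have "f 0 \<le> f x" by (intro b) auto
    moreover have "f x0 \<le> f 0" by (rule x0) auto
    ultimately show ?thesis by simp
  qed (rule x0)
  then show ?thesis by blast
qed

text \<open>The growth condition controls \<open>f\<close> far out, and compactness bounds it on the
  remaining interval. A natural exponent \<open>k\<close> makes the binomial theorem and the
  Gaussian moments applicable.\<close>

lemma C_p_power_bound:
  assumes "f \<in> C_p"
  obtains C :: real and k :: nat where "\<And>x. \<bar>f x\<bar> \<le> C + \<bar>x\<bar> ^ k"
proof -
  from assms obtain m where cont: "continuous_on UNIV f" and m: "m > 0"
    and lim: "((\<lambda>x. f x / \<bar>x\<bar> powr m) \<longlongrightarrow> 0) at_infinity"
    unfolding C_p_def by blast
  have "eventually (\<lambda>x. \<bar>f x / \<bar>x\<bar> powr m\<bar> < 1) at_infinity"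
    using tendstoD[OF lim, of 1] by (simp add: dist_real_def)
  then obtain b where b: "\<And>x. b \<le> \<bar>x\<bar> \<Longrightarrow> \<bar>f x / \<bar>x\<bar> powr m\<bar> < 1"
    unfolding eventually_at_infinity by auto
  \<comment> \<open>From \<open>\<bar>x\<bar> \<ge> 1\<close> on, \<open>powr\<close> is monotone in
    its exponent, so \<open>m\<close> may be rounded up to \<open>k\<close>.\<close>
  define B where "B = max b 1"
  define k where "k = nat \<lceil>m\<rceil>"
  have large: "\<bar>f x\<bar> \<le> \<bar>x\<bar> ^ k" if "B \<le> \<bar>x\<bar>" for x
  proof -
    have x1: "1 \<le> \<bar>x\<bar>" and xb: "b \<le> \<bar>x\<bar>" using that by (auto simp: B_def)
    have "\<bar>f x\<bar> \<le> \<bar>x\<bar> powr m"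
      using b[OF xb] x1 by (auto simp: abs_divide field_simps)
    also have "\<dots> \<le> \<bar>x\<bar> powr real k"
      using x1 by (intro powr_mono) (auto simp: k_def real_nat_ceiling_ge)
    also have "\<dots> = \<bar>x\<bar> ^ k" using x1 by (intro powr_realpow) auto
    finally show ?thesis .
  qed
  have "bounded (f ` cball 0 B)"
    using cont by (intro compact_imp_bounded compact_continuous_image) (auto intro: continuous_on_subset)
  then obtain C where C: "\<And>x. \<bar>x\<bar> \<le> B \<Longrightarrow> \<bar>f x\<bar> \<le> C"
    by (force simp: bounded_iff Ball_def)
  \<comment> \<open>The sign of \<open>C\<close> matters for large \<open>\<bar>x\<bar>\<close>,
    where only \<open>\<bar>x\<bar> ^ k\<close> is known to bound
    \<open>\<bar>f x\<bar>\<close>.\<close>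
  have "0 \<le> \<bar>f 0\<bar>" by simp
  also have "\<bar>f 0\<bar> \<le> C" by (rule C) (simp add: B_def)
  finally have "0 \<le> C" .
  have "\<bar>f x\<bar> \<le> C + \<bar>x\<bar> ^ k" for x
    using large[of x] C[of x] \<open>0 \<le> C\<close> zero_le_power[of "\<bar>x\<bar>" k]
    by (cases "\<bar>x\<bar> \<le> B") linarith+
  then show thesis by (rule that)
qed

text \<open>Supplies the dominating functions below. Binomial expansion reduces it to absolute
  moments of the standard normal law.\<close>

lemma std_normal_integrable_linear_power:
  fixes a b c :: real
  shows "integrable lborel (\<lambda>y. (c + (a + b * \<bar>y\<bar>) ^ k) * std_normal_density y)"
proof -
  have mom: "integrable lborel (\<lambda>y. std_normal_density y * \<bar>y\<bar> ^ j)" for j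
    using integrable_normal_moment_abs[of 1 0 j] by simp
  \<comment> \<open>The constant \<open>c\<close> is written with the zeroth moment so that
    \<open>mom\<close> covers every summand.\<close>
  have "(\<lambda>y. (c + (a + b * \<bar>y\<bar>) ^ k) * std_normal_density y) =
     (\<lambda>y. c * (std_normal_density y * \<bar>y\<bar> ^ 0) + (\<Sum>j\<le>k. (of_nat (k choose j) * a ^ j * b ^ (k - j)) *
        (std_normal_density y * \<bar>y\<bar> ^ (k - j))))"
    by (simp add: binomial_ring sum_distrib_left power_mult_distrib algebra_simps)
  then show ?thesis
    using mom by (auto intro!: Bochner_Integration.integrable_add integrable_mult_right
        Bochner_Integration.integrable_sum simp del: power_0)
qed

lemma std_normal_density_affine:
  assumes "\<sigma> > 0"
  shows "\<sigma> * normal_density \<mu> \<sigma> (\<mu> + \<sigma> * y) = std_normal_density y"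
  using assms by (simp add: normal_density_def real_sqrt_mult power_mult_distrib)

text \<open>The substitution moves \<open>\<mu>\<close> and \<open>\<sigma>\<close> from the density
  into the argument of \<open>f\<close>, so that limits in \<open>\<sigma>\<close> are taken against
  a fixed density. The Jacobian \<open>\<sigma>\<close> cancels the one in the normalising
  constant.\<close>

lemma relaxed_eq_std_normal:
  assumes "\<sigma> > 0"
  shows "relaxed f \<mu> \<sigma> = (LINT y|lborel. f (\<mu> + \<sigma> * y) * std_normal_density y)"
proof -
  have "relaxed f \<mu> \<sigma> =
      \<sigma> * (LINT y|lborel. f (\<mu> + \<sigma> * y) * normal_density \<mu> \<sigma> (\<mu> + \<sigma> * y))"
    unfolding relaxed_def
    by (subst lborel_integral_real_affine[where c=\<sigma> and t=\<mu>]) (use assms in auto)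
  also have "\<dots> = (LINT y|lborel. f (\<mu> + \<sigma> * y) * (\<sigma> * normal_density \<mu> \<sigma> (\<mu> + \<sigma> * y)))"
    by (subst integral_mult_right_zero[symmetric]) (simp only: mult.left_commute)
  finally show ?thesis
    by (simp only: std_normal_density_affine[OF assms])
qed

lemma integrable_normal_density_iff_std:
  fixes f :: "real \<Rightarrow> real"
  assumes "\<sigma> > 0"
  shows "integrable lborel (\<lambda>x. f x * normal_density \<mu> \<sigma> x) \<longleftrightarrow>
    integrable lborel (\<lambda>y. f (\<mu> + \<sigma> * y) * std_normal_density y)"
proof -
  have "integrable lborel (\<lambda>x. f x * normal_density \<mu> \<sigma> x) \<longleftrightarrow>
      integrable lborel (\<lambda>y. f (\<mu> + \<sigma> * y) * normal_density \<mu> \<sigma> (\<mu> + \<sigma> * y))"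
    using assms by (subst lborel_integrable_real_affine_iff[of \<sigma> _ \<mu>, symmetric]) auto
  also have "\<dots> \<longleftrightarrow> integrable lborel
      (\<lambda>y. \<sigma> * (f (\<mu> + \<sigma> * y) * normal_density \<mu> \<sigma> (\<mu> + \<sigma> * y)))"
    using assms by simp
  also have "\<dots> \<longleftrightarrow> integrable lborel (\<lambda>y. f (\<mu> + \<sigma> * y) * std_normal_density y)"
    by (simp only: mult.left_commute[of \<sigma>] std_normal_density_affine[OF assms])
  finally show ?thesis .
qed

lemma C_p_measurable [measurable]: "f \<in> C_p \<Longrightarrow> f \<in> borel_measurable borel"
  by (simp add: C_p_def borel_measurable_continuous_onI)

lemma C_p_integrable_normal_density:
  assumes f: "f \<in> C_p" and \<sigma>: "\<sigma> > 0"
  shows "integrable lborel (\<lambda>x. f x * normal_density \<mu> \<sigma> x)"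
proof -
  note [measurable] = C_p_measurable[OF f]
  obtain C k where bound: "\<And>x. \<bar>f x\<bar> \<le> C + \<bar>x\<bar> ^ k"
    using C_p_power_bound[OF f] by blast
  have "\<bar>f (\<mu> + \<sigma> * y)\<bar> \<le> C + (\<bar>\<mu>\<bar> + \<sigma> * \<bar>y\<bar>) ^ k" for y
  proof -
    have "\<bar>\<mu> + \<sigma> * y\<bar> \<le> \<bar>\<mu>\<bar> + \<sigma> * \<bar>y\<bar>"
      using abs_triangle_ineq[of \<mu> "\<sigma> * y"] \<sigma> by (simp add: abs_mult)
    then show ?thesis
      using bound[of "\<mu> + \<sigma> * y"] power_mono[of "\<bar>\<mu> + \<sigma> * y\<bar>" "\<bar>\<mu>\<bar> + \<sigma> * \<bar>y\<bar>" k] by simp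
  qed
  then have "integrable lborel (\<lambda>y. f (\<mu> + \<sigma> * y) * std_normal_density y)"
    by (intro Bochner_Integration.integrable_bound
        [OF std_normal_integrable_linear_power[of C "\<bar>\<mu>\<bar>" \<sigma> k]])
      (auto simp: abs_mult intro!: AE_I2 mult_right_mono intro: order_trans[OF _ abs_ge_self])
  then show ?thesis
    by (simp add: integrable_normal_density_iff_std[OF \<sigma>])
qed

text \<open>The density has total mass 1, so the constant \<open>m\<close> is its own Gaussian mean,
  and the integral is monotone.\<close>

lemma relaxed_ge_lower_bound:
  assumes f: "f \<in> C_p" and \<sigma>: "\<sigma> > 0" and lower: "\<And>x. m \<le> f x"
  shows "m \<le> relaxed f \<mu> \<sigma>"
proof -
  have "m = (LINT x|lborel. m * normal_density \<mu> \<sigma> x)"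
    using \<sigma> by simp
  also have "\<dots> \<le> relaxed f \<mu> \<sigma>"
    unfolding relaxed_def using \<sigma> lower
    by (intro integral_mono C_p_integrable_normal_density[OF f]) (auto intro: mult_right_mono)
  finally show ?thesis .
qed

lemma relaxed_tendsto:
  assumes f: "f \<in> C_p"
  shows "(\<lambda>n. relaxed f \<mu> (1 / real (Suc n))) \<longlonglongrightarrow> f \<mu>"
proof -
  note [measurable] = C_p_measurable[OF f]
  obtain C k where bound: "\<And>x. \<bar>f x\<bar> \<le> C + \<bar>x\<bar> ^ k"
    using C_p_power_bound[OF f] by blast
  \<comment> \<open>All widths are at most 1, so one bound serves every \<open>n\<close>. The factor
    \<open>1 *\<close> matches the form \<open>a + b * \<bar>y\<bar>\<close> of the integrability
    lemma.\<close>
  have dominated: "\<bar>f (\<mu> + 1 / real (Suc n) * y)\<bar> \<le> C + (\<bar>\<mu>\<bar> + 1 * \<bar>y\<bar>) ^ k" for n y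
  proof -
    have "\<bar>1 / real (Suc n) * y\<bar> \<le> 1 * \<bar>y\<bar>"
      unfolding abs_mult by (intro mult_right_mono) auto
    then have "\<bar>\<mu> + 1 / real (Suc n) * y\<bar> \<le> \<bar>\<mu>\<bar> + 1 * \<bar>y\<bar>"
      by linarith
    then show ?thesis
      using bound[of "\<mu> + 1 / real (Suc n) * y"]
        power_mono[of "\<bar>\<mu> + 1 / real (Suc n) * y\<bar>" "\<bar>\<mu>\<bar> + 1 * \<bar>y\<bar>" k] by simp
  qed
  have pointwise: "(\<lambda>n. f (\<mu> + 1 / real (Suc n) * y)) \<longlonglongrightarrow> f \<mu>" for y
  proof -
    have "(\<lambda>n. \<mu> + 1 / real (Suc n) * y) \<longlonglongrightarrow> \<mu> + 0 * y"
      by (intro tendsto_intros LIMSEQ_Suc[OF lim_1_over_n])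
    moreover have "isCont f \<mu>"
      using f by (simp add: C_p_def continuous_on_eq_continuous_at)
    ultimately show ?thesis
      using isCont_tendsto_compose[of \<mu> f] by simp
  qed
  have "(\<lambda>n. LINT y|lborel. f (\<mu> + 1 / real (Suc n) * y) * std_normal_density y)
      \<longlonglongrightarrow> (LINT y|lborel. f \<mu> * std_normal_density y)"
  proof (rule integral_dominated_convergence[OF _ _ std_normal_integrable_linear_power])
    show "AE y in lborel. norm (f (\<mu> + 1 / real (Suc n) * y) * std_normal_density y)
        \<le> (C + (\<bar>\<mu>\<bar> + 1 * \<bar>y\<bar>) ^ k) * std_normal_density y" for n
      using dominated by (intro AE_I2) (simp add: abs_mult mult_right_mono)
    show "AE y in lborel. (\<lambda>n. f (\<mu> + 1 / real (Suc n) * y) * std_normal_density y)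
        \<longlonglongrightarrow> f \<mu> * std_normal_density y"
      by (intro AE_I2 tendsto_mult_right pointwise)
  qed simp_all
  then show ?thesis
    by (simp add: relaxed_eq_std_normal)
qed

text \<open>The first two conjuncts ensure that the final equation does not rest on default values:
  the integral of a non-integrable function is \<open>0\<close>, and \<open>Inf\<close> of a real
  set unbounded below carries no meaning.\<close>

theorem proposition2p4:
  fixes f :: "real \<Rightarrow> real"
  assumes "f \<in> C_p"
    and "filterlim f at_top at_infinity"
  shows "(\<forall>\<mu> \<sigma>. \<sigma> > 0 \<longrightarrow> integrable lborel (\<lambda>x. f x * normal_density \<mu> \<sigma> x)) \<and>
    bdd_below {relaxed f \<mu> \<sigma> | \<mu> \<sigma>. \<sigma> > 0} \<and>
    (\<exists>x0. (\<forall>x. f x0 \<le> f x) \<and> Inf {relaxed f \<mu> \<sigma> | \<mu> \<sigma>. \<sigma> > 0} = f x0)"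
proof -
  let ?S = "{relaxed f \<mu> \<sigma> | \<mu> \<sigma>. \<sigma> > 0}"
  have "continuous_on UNIV f" using assms(1) by (simp add: C_p_def)
  then obtain x0 where x0: "\<And>x. f x0 \<le> f x"
    using continuous_attains_inf_at_top_at_infinity assms(2) by blast
  have lower: "f x0 \<le> v" if "v \<in> ?S" for v
    using that relaxed_ge_lower_bound[OF assms(1) _ x0] by blast
  then have bdd: "bdd_below ?S" by (rule bdd_belowI)
  \<comment> \<open>These values tend to \<open>f x0\<close> and each is at least
    \<open>Inf ?S\<close>, which gives the upper bound. They also show that \<open>?S\<close> is
    nonempty, as \<open>cInf_greatest\<close> requires.\<close>
  have in_S: "relaxed f x0 (1 / real (Suc n)) \<in> ?S" for n
    by fastforce
  have "Inf ?S = f x0"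
  proof (rule antisym)
    show "Inf ?S \<le> f x0"
      using relaxed_tendsto[OF assms(1)] by (rule LIMSEQ_le_const) (use cInf_lower[OF in_S bdd] in blast)
    show "f x0 \<le> Inf ?S"
      using in_S lower by (intro cInf_greatest) blast+
  qed
  then show ?thesis
    using C_p_integrable_normal_density[OF assms(1)] bdd x0 by blast
qed

end
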